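(* Let $E$ be the edge set of a finite graph. For every $e\in E$ let $\Omega_1(e)=\{000,011,101,110\}$ with $\mu_1$ the uniform probability measure assigning $\frac14$ to each element, and let $\Omega_2(e)=\{000,001,010,011,100,101,110,111\}$ with $\mu_2$ the uniform probability measure assigning $\frac18$ to each element. Let $C$ be the random configuration built by an arbitrary generating decision tree, $C_1$ the one built by a generating decision tree all of whose decisions are $1$, and $C_2$ the one built by a generating decision tree all of whose decisions are $2$. Let $\mathcal U,\mathcal V,\mathcal W\subseteq\{0,1\}^E$ be closed upward. Then $$\mathbf{P}(C_1\in\mathcal U\times\mathcal V)=\mathbf{P}(C\in\mathcal U\times\mathcal V)=\mathbf{P}(C_2\in\mathcal U\times\mathcal V)$$ and $$\mathbf{P}(C_1\in\mathcal U\times\mathcal V\times\mathcal W)\le\mathbf{P}(C\in\mathcal U\times\mathcal V\times\mathcal W)\le\mathbf{P}(C_2\in\mathcal U\times\mathcal V\times\mathcal W).$$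
   Context: A set $\mathcal U\subseteq\{0,1\}^E$ is closed upward if $x\in\mathcal U$ and $x\le y$ coordinatewise imply $y\in\mathcal U$. A generating decision tree is a finite rooted tree in which each node $N$ carries an edge $e(N)\in E$ and a decision $D(N)\in\{1,2\}$. When a node $N$ with $D(N)=i$ is visited, a random element of $\Omega_i(e(N))$ is generated according to $\mu_i$ (independently of everything generated before) and assigned to the edge $e(N)$; if $N$ is not a leaf, it has children indexed by the elements of $\Omega_i(e(N))$, and one moves to the child indexed by the generated element. Every path from the root to a leaf contains each edge of $E$ exactly once. Thus a run from the root produces a random configuration in $\prod_{e\in E}(\Omega_1(e)\cup\Omega_2(e))$; $\mathbf{P}$ is the induced distribution. For such a configuration, let $E_1,E_2,E_3\in\{0,1\}^E$ be formed by the first, second and third digits, respectively, of the triplets on the edges. The configuration belongs to $\mathcal U\times\mathcal V\times\mathcal W$ if $E_1\in\mathcal U$, $E_2\in\mathcal V$ and $E_3\in\mathcal W$; it belongs to $\mathcal U\times\mathcal V$ if $E_1\in\mathcal U$ and $E_2\in\mathcal V$. *)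

theory Defs
  imports "HOL-Probability.Probability"
begin

text \<open>Undirected multigraphs, loops allowed: \<open>ends e\<close> is the set of endpoints of \<open>e\<close>.\<close>

definition finite_graph :: "'v set \<Rightarrow> 'e set \<Rightarrow> ('e \<Rightarrow> 'v set) \<Rightarrow> bool" where
  "finite_graph VG E ends \<longleftrightarrow> finite VG \<and> finite E \<and>
     (\<forall>e\<in>E. ends e \<subseteq> VG \<and> card (ends e) \<in> {1, 2})"

text \<open>The digits 0 and 1 are \<open>False\<close> and \<open>True\<close>.  An element of \<open>{0,1}\<close> to the power \<open>E\<close>
  is a function in \<open>E \<rightarrow>\<^sub>E UNIV\<close>, hence \<open>undefined\<close> outside \<open>E\<close>.\<close>

definition cube :: "'e set \<Rightarrow> ('e \<Rightarrow> bool) set" where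
  "cube E = E \<rightarrow>\<^sub>E UNIV"

definition closed_upward :: "'e set \<Rightarrow> ('e \<Rightarrow> bool) set \<Rightarrow> bool" where
  "closed_upward E U \<longleftrightarrow> U \<subseteq> cube E \<and>
     (\<forall>x\<in>U. \<forall>y\<in>cube E. (\<forall>e\<in>E. x e \<le> y e) \<longrightarrow> y \<in> U)"

type_synonym triplet = "bool \<times> bool \<times> bool"

datatype decision = Dec1 | Dec2

text \<open>The sample spaces are the same for every edge, so no edge argument is carried.\<close>

fun Omega :: "decision \<Rightarrow> triplet set" where
  "Omega Dec1 = {(False, False, False), (False, True, True), (True, False, True), (True, True, False)}"
| "Omega Dec2 = {(False, False, False), (False, False, True), (False, True, False), (False, True, True),
                 (True, False, False), (True, False, True), (True, True, False), (True, True, True)}"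

definition mu :: "decision \<Rightarrow> triplet pmf" where
  "mu d = pmf_of_set (Omega d)"

text \<open>Only the children \<open>ch t\<close> with \<open>t \<in> Omega d\<close> belong to the tree \<open>Node e d ch\<close>; the values
  of \<open>ch\<close> at other triplets are ignored by everything below.\<close>

datatype 'e dtree = Leaf 'e decision | Node 'e decision "triplet \<Rightarrow> 'e dtree"

text \<open>The edge sequences read along the paths from the root to a leaf.\<close>

primrec edge_paths :: "'e dtree \<Rightarrow> 'e list set" where
  "edge_paths (Leaf e d) = {[e]}"
| "edge_paths (Node e d ch) = (\<Union>t\<in>Omega d. (\<lambda>p. e # p) ` edge_paths (ch t))"

primrec decisions :: "'e dtree \<Rightarrow> decision set" where
  "decisions (Leaf e d) = {d}"
| "decisions (Node e d ch) = insert d (\<Union>t\<in>Omega d. decisions (ch t))"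

text \<open>Every node lies on some path from the root to a leaf, so this also puts the edges of all
  nodes in \<open>E\<close>.\<close>

definition generating_tree :: "'e set \<Rightarrow> 'e dtree \<Rightarrow> bool" where
  "generating_tree E T \<longleftrightarrow> (\<forall>p\<in>edge_paths T. distinct p \<and> set p = E)"

text \<open>The law of the random configuration produced by a run from the root.  For a generating
  tree it is supported on \<open>E \<rightarrow>\<^sub>E UNIV\<close>.\<close>

primrec config :: "'e dtree \<Rightarrow> ('e \<Rightarrow> triplet) pmf" where
  "config (Leaf e d) = map_pmf (\<lambda>t. (\<lambda>_. undefined)(e := t)) (mu d)"
| "config (Node e d ch) =
     bind_pmf (mu d) (\<lambda>t. map_pmf (\<lambda>c. c(e := t)) (config (ch t)))"

definition digits1 :: "'e set \<Rightarrow> ('e \<Rightarrow> triplet) \<Rightarrow> 'e \<Rightarrow> bool" where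
  "digits1 E c = (\<lambda>e\<in>E. fst (c e))"

definition digits2 :: "'e set \<Rightarrow> ('e \<Rightarrow> triplet) \<Rightarrow> 'e \<Rightarrow> bool" where
  "digits2 E c = (\<lambda>e\<in>E. fst (snd (c e)))"

definition digits3 :: "'e set \<Rightarrow> ('e \<Rightarrow> triplet) \<Rightarrow> 'e \<Rightarrow> bool" where
  "digits3 E c = (\<lambda>e\<in>E. snd (snd (c e)))"

definition event2 :: "'e set \<Rightarrow> ('e \<Rightarrow> bool) set \<Rightarrow> ('e \<Rightarrow> bool) set \<Rightarrow> ('e \<Rightarrow> triplet) set" where
  "event2 E U V = {c. digits1 E c \<in> U \<and> digits2 E c \<in> V}"

definition event3 ::
  "'e set \<Rightarrow> ('e \<Rightarrow> bool) set \<Rightarrow> ('e \<Rightarrow> bool) set \<Rightarrow> ('e \<Rightarrow> bool) set \<Rightarrow> ('e \<Rightarrow> triplet) set" where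
  "event3 E U V W = {c. digits1 E c \<in> U \<and> digits2 E c \<in> V \<and> digits3 E c \<in> W}"

end

theory Submission imports Defs begin

text \<open>
  Resample a single edge while all other edges keep their triplets.  Membership of the first,
  second and third digits in \<open>U\<close>, \<open>V\<close>, \<open>W\<close> then becomes three increasing predicates \<open>u\<close>, \<open>v\<close>, \<open>w\<close>
  of the digits of the new triplet, and an increasing predicate on one digit is constantly
  false, constantly true, or the digit itself.  Under both decisions any two digits
  are independent and uniform, so the two decisions give \<open>u \<and> v \<and> w\<close> the same probability as soon
  as one of the predicates is constant.  In the remaining case the triplet must be \<open>111\<close>,
  which has probability \<open>0\<close> under the first decision and \<open>1/8\<close> under the second.  Hence
  on one edge the first decision never beats the second (\<open>three_digits_Dec1_le_Dec2\<close>), and for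
  events about the first two digits the decisions are equivalent (\<open>two_digits_independent\<close>).

  A whole tree is compared with the product law in which every edge is
  sampled with one and the same decision.  By induction each subtree below the root is at least
  as likely to produce the event as the product law on the remaining edges.  That product law
  does not depend on the triplet generated at the root, so the root can be sampled last, and its
  decision is changed by the single-edge comparison (\<open>product_le_tree\<close>).  Complements turn
  this lower bound into an upper bound, and the two bounds together show that the law of a tree
  with constant decision is the product law itself.
\<close>

section \<open>Comparing a decision tree with a product law\<close>

lemma generating_tree_Leaf:
  assumes "generating_tree E (Leaf e d)"
  shows "E = {e}"
  using assms by (auto simp: generating_tree_def)

lemma edge_paths_nonempty: "edge_paths T \<noteq> {}"
proof (induction T)
  case (Node e d ch)
  then show ?case by (cases d) auto
qed simp

lemma generating_tree_Node:
  assumes "generating_tree E (Node e d ch)"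
  shows "e \<in> E" and "\<And>t. t \<in> Omega d \<Longrightarrow> generating_tree (E - {e}) (ch t)"
proof -
  have path: "distinct (e # p) \<and> set (e # p) = E"
    if "t \<in> Omega d" "p \<in> edge_paths (ch t)" for t p
    using assms that unfolding generating_tree_def by auto
  have "(False, False, False) \<in> Omega d"
    by (cases d) auto
  then show "e \<in> E"
    using path edge_paths_nonempty by fastforce
  show "generating_tree (E - {e}) (ch t)" if "t \<in> Omega d" for t
    unfolding generating_tree_def using path[OF that] by auto
qed

lemma generating_tree_finite:
  assumes "generating_tree E T"
  shows "finite E"
  using assms edge_paths_nonempty[of T] unfolding generating_tree_def by auto

lemma set_mu: "set_pmf (mu d) = Omega d"
  unfolding mu_def by (cases d) (simp_all add: set_pmf_of_set)

lemma prob_bind_pmf: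
  "measure_pmf.prob (bind_pmf p f) A = measure_pmf.expectation p (\<lambda>x. measure_pmf.prob (f x) A)"
proof -
  have "ennreal (measure_pmf.prob (bind_pmf p f) A) =
      (\<integral>\<^sup>+x. ennreal (measure_pmf.prob (f x) A) \<partial>measure_pmf p)"
    by (simp add: emeasure_bind_pmf flip: measure_pmf.emeasure_eq_measure)
  also have "\<dots> = ennreal (measure_pmf.expectation p (\<lambda>x. measure_pmf.prob (f x) A))"
    by (intro nn_integral_eq_integral measure_pmf.integrable_const_bound[where B = 1]) auto
  finally show ?thesis
    by (simp add: ennreal_inj)
qed

lemma expectation_prob_mono:
  assumes "\<And>x. x \<in> set_pmf p \<Longrightarrow> measure_pmf.prob (f x) (A x) \<le> measure_pmf.prob (g x) (B x)"
  shows "measure_pmf.expectation p (\<lambda>x. measure_pmf.prob (f x) (A x))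
    \<le> measure_pmf.expectation p (\<lambda>x. measure_pmf.prob (g x) (B x))"
  using assms
  by (intro integral_mono_AE measure_pmf.integrable_const_bound[where B = 1])
     (auto simp: AE_measure_pmf_iff)

text \<open>The hypothesis is inherited by the sections of \<open>A\<close> at a fixed triplet on the root edge,
  since assignments to different edges commute; this is what the induction needs.\<close>

lemma product_le_tree:
  assumes "generating_tree E T"
    and "\<And>d e c. d \<in> decisions T \<Longrightarrow> e \<in> E \<Longrightarrow>
      measure_pmf.prob q {t. c(e := t) \<in> A} \<le> measure_pmf.prob (mu d) {t. c(e := t) \<in> A}"
  shows "measure_pmf.prob (Pi_pmf E undefined (\<lambda>_. q)) A \<le> measure_pmf.prob (config T) A"
  using assms
proof (induction T arbitrary: E A)
  case (Leaf e d)
  have E: "E = {e}"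
    using Leaf.prems(1) by (rule generating_tree_Leaf)
  have "(\<lambda>t b. if b = e then t else undefined) = (\<lambda>t. (\<lambda>_. undefined)(e := t))"
    by (auto simp: fun_eq_iff)
  then show ?case
    using Leaf.prems(2)[of d e "\<lambda>_. undefined"] by (simp add: E Pi_pmf_singleton vimage_def fun_upd_def)
next
  case (Node e d ch)
  define Q where "Q = Pi_pmf (E - {e}) undefined (\<lambda>_. q)"
  note tree = generating_tree_Node[OF Node.prems(1)]
  have fin: "finite (E - {e})"
    using generating_tree_finite[OF Node.prems(1)] by simp
  have subtree: "measure_pmf.prob Q {c. c(e := t) \<in> A}
      \<le> measure_pmf.prob (config (ch t)) {c. c(e := t) \<in> A}" if t: "t \<in> Omega d" for t
    unfolding Q_def
  proof (rule Node.IH[OF _ tree(2)[OF t]])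
    fix d' e' and c :: "'a \<Rightarrow> triplet"
    assume "d' \<in> decisions (ch t)" and e': "e' \<in> E - {e}"
    then have "d' \<in> decisions (Node e d ch)"
      using t by auto
    moreover have "c(e := t, e' := s) = c(e' := s, e := t)" for s
      using e' by (intro fun_upd_twist) auto
    ultimately
    show "measure_pmf.prob q {s. c(e' := s) \<in> {c. c(e := t) \<in> A}}
        \<le> measure_pmf.prob (mu d') {s. c(e' := s) \<in> {c. c(e := t) \<in> A}}"
      using Node.prems(2)[of d' e' "c(e := t)"] e' by (simp only: mem_Collect_eq Diff_iff)
  qed simp
  have "Pi_pmf E undefined (\<lambda>_. q) = Pi_pmf (insert e (E - {e})) undefined (\<lambda>_. q)"
    using tree(1) by (simp add: insert_absorb)
  \<comment> \<open>Sample the root edge last, so that its law can be changed with the other edges fixed.\<close>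
  also have "\<dots> = bind_pmf Q (\<lambda>c. map_pmf (\<lambda>t. c(e := t)) q)"
    unfolding Q_def using fin
    by (subst Pi_pmf_insert', simp, simp, subst bind_commute_pmf)
       (simp add: map_pmf_def)
  finally have "measure_pmf.prob (Pi_pmf E undefined (\<lambda>_. q)) A
      = measure_pmf.expectation Q (\<lambda>c. measure_pmf.prob q {t. c(e := t) \<in> A})"
    by (simp add: prob_bind_pmf vimage_def)
  also have "\<dots> \<le> measure_pmf.expectation Q (\<lambda>c. measure_pmf.prob (mu d) {t. c(e := t) \<in> A})"
    by (intro expectation_prob_mono Node.prems(2) tree(1)) simp
  also have "\<dots> = measure_pmf.prob (bind_pmf Q (\<lambda>c. map_pmf (\<lambda>t. c(e := t)) (mu d))) A"
    by (simp add: prob_bind_pmf vimage_def)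
  \<comment> \<open>Sample the root edge first again, as the tree does, and then let the subtrees take over.\<close>
  also have "bind_pmf Q (\<lambda>c. map_pmf (\<lambda>t. c(e := t)) (mu d))
      = bind_pmf (mu d) (\<lambda>t. map_pmf (\<lambda>c. c(e := t)) Q)"
    unfolding map_pmf_def by (rule bind_commute_pmf)
  also have "measure_pmf.prob \<dots> A
      = measure_pmf.expectation (mu d) (\<lambda>t. measure_pmf.prob Q {c. c(e := t) \<in> A})"
    by (simp add: prob_bind_pmf vimage_def)
  also have "\<dots> \<le> measure_pmf.expectation (mu d)
      (\<lambda>t. measure_pmf.prob (config (ch t)) {c. c(e := t) \<in> A})"
    by (intro expectation_prob_mono subtree) (simp add: set_mu)
  also have "\<dots> = measure_pmf.prob (config (Node e d ch)) A"
    by (simp add: prob_bind_pmf vimage_def)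
  finally show ?case .
qed

lemma prob_Compl_pmf: "measure_pmf.prob p (- A) = 1 - measure_pmf.prob p A"
  using measure_pmf.prob_compl[of A p] by (simp add: Compl_eq_Diff_UNIV)

lemma tree_le_product:
  assumes "generating_tree E T"
    and "\<And>d e c. d \<in> decisions T \<Longrightarrow> e \<in> E \<Longrightarrow>
      measure_pmf.prob (mu d) {t. c(e := t) \<in> A} \<le> measure_pmf.prob q {t. c(e := t) \<in> A}"
  shows "measure_pmf.prob (config T) A \<le> measure_pmf.prob (Pi_pmf E undefined (\<lambda>_. q)) A"
proof -
  have compl: "{t. c(e := t) \<in> - A} = - {t. c(e := t) \<in> A}"
    for c :: "'a \<Rightarrow> triplet" and e
    by auto
  have "measure_pmf.prob (Pi_pmf E undefined (\<lambda>_. q)) (- A) \<le> measure_pmf.prob (config T) (- A)"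
    by (intro product_le_tree assms(1)) (simp only: compl prob_Compl_pmf, simp add: assms(2))
  then show ?thesis
    by (simp add: prob_Compl_pmf)
qed

text \<open>With a constant decision the single-edge comparison holds with equality for every event, so
  both bounds apply.\<close>

lemma constant_tree_eq_product:
  assumes "generating_tree E T" and "\<forall>d'\<in>decisions T. d' = d"
  shows "measure_pmf.prob (config T) A = measure_pmf.prob (Pi_pmf E undefined (\<lambda>_. mu d)) A"
  using assms by (intro antisym tree_le_product product_le_tree) auto

section \<open>Resampling a single edge\<close>

lemma prob_mu: "measure_pmf.prob (mu d) S = card (Omega d \<inter> S) / card (Omega d)"
  unfolding mu_def by (cases d) (subst measure_pmf_of_set; simp)+

text \<open>Under both decisions the first two digits form a uniform pair of bits.\<close>

lemma two_digits_independent: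
  "measure_pmf.prob (mu d) {t. u (fst t) \<and> v (fst (snd t))}
    = measure_pmf.prob (mu d') {t. u (fst t) \<and> v (fst (snd t))}"
  by (cases d; cases d'; cases "u False"; cases "u True"; cases "v False"; cases "v True")
     (simp_all add: prob_mu Int_insert_left)

text \<open>Without monotonicity the inequality may fail: the triplet \<open>000\<close> has
  probability \<open>1/4\<close> under the first decision but only \<open>1/8\<close> under the second.  With it, the two
  sides differ only when \<open>111\<close> is the one triplet allowed.\<close>

lemma three_digits_Dec1_le_Dec2:
  assumes "u False \<Longrightarrow> u True" and "v False \<Longrightarrow> v True" and "w False \<Longrightarrow> w True"
  shows "measure_pmf.prob (mu Dec1) {t. u (fst t) \<and> v (fst (snd t)) \<and> w (snd (snd t))}
    \<le> measure_pmf.prob (mu Dec2) {t. u (fst t) \<and> v (fst (snd t)) \<and> w (snd (snd t))}"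
  using assms
  by (cases "u False"; cases "u True"; cases "v False"; cases "v True";
      cases "w False"; cases "w True")
     (simp_all add: prob_mu Int_insert_left)

lemma digits_upd:
  assumes "e \<in> E"
  shows "digits1 E (c(e := t)) = (digits1 E c)(e := fst t)"
    and "digits2 E (c(e := t)) = (digits2 E c)(e := fst (snd t))"
    and "digits3 E (c(e := t)) = (digits3 E c)(e := snd (snd t))"
  using assms by (auto simp: digits1_def digits2_def digits3_def fun_eq_iff)

lemma closed_upward_upd:
  assumes "closed_upward E U" and "e \<in> E" and "x(e := False) \<in> U"
  shows "x(e := True) \<in> U"
proof -
  have "x(e := False) \<in> cube E"
    using assms unfolding closed_upward_def by auto
  then have "x(e := True) \<in> cube E"
    using assms(2) unfolding cube_def PiE_def extensional_def by auto
  moreover have "\<forall>i\<in>E. (x(e := False)) i \<le> (x(e := True)) i"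
    by auto
  ultimately show ?thesis
    using assms unfolding closed_upward_def by blast
qed

lemma event2_edge:
  assumes "e \<in> E"
  shows "measure_pmf.prob (mu d) {t. c(e := t) \<in> event2 E U V}
    = measure_pmf.prob (mu d') {t. c(e := t) \<in> event2 E U V}"
  unfolding event2_def mem_Collect_eq digits_upd[OF assms]
  by (rule two_digits_independent)

lemma event3_edge:
  assumes "closed_upward E U" "closed_upward E V" "closed_upward E W" and e: "e \<in> E"
  shows "measure_pmf.prob (mu Dec1) {t. c(e := t) \<in> event3 E U V W}
    \<le> measure_pmf.prob (mu Dec2) {t. c(e := t) \<in> event3 E U V W}"
  unfolding event3_def mem_Collect_eq digits_upd[OF e]
  by (rule three_digits_Dec1_le_Dec2) (rule closed_upward_upd, rule assms, rule e, assumption)+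

section \<open>Comparison of the three trees\<close>

theorem theorem8p6:
  fixes VG :: "'v set" and E :: "'e set" and ends :: "'e \<Rightarrow> 'v set"
    and T T1 T2 :: "'e dtree" and U V W :: "('e \<Rightarrow> bool) set"
  assumes "finite_graph VG E ends"
    and "generating_tree E T"
    and "generating_tree E T1" and "\<forall>d\<in>decisions T1. d = Dec1"
    and "generating_tree E T2" and "\<forall>d\<in>decisions T2. d = Dec2"
    and "closed_upward E U" and "closed_upward E V" and "closed_upward E W"
  shows "(measure_pmf.prob (config T1) (event2 E U V) = measure_pmf.prob (config T) (event2 E U V) \<and>
      measure_pmf.prob (config T) (event2 E U V) = measure_pmf.prob (config T2) (event2 E U V)) \<and>
    (measure_pmf.prob (config T1) (event3 E U V W) \<le> measure_pmf.prob (config T) (event3 E U V W) \<and>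
      measure_pmf.prob (config T) (event3 E U V W) \<le> measure_pmf.prob (config T2) (event3 E U V W))"
proof -
  have T1: "measure_pmf.prob (config T1) A
      = measure_pmf.prob (Pi_pmf E undefined (\<lambda>_. mu Dec1)) A" for A
    using assms(3,4) by (rule constant_tree_eq_product)
  have T2: "measure_pmf.prob (config T2) A
      = measure_pmf.prob (Pi_pmf E undefined (\<lambda>_. mu Dec2)) A" for A
    using assms(5,6) by (rule constant_tree_eq_product)
  have two: "measure_pmf.prob (config T) (event2 E U V)
      = measure_pmf.prob (Pi_pmf E undefined (\<lambda>_. mu d)) (event2 E U V)" for d
    by (rule antisym; rule tree_le_product product_le_tree, rule assms(2), rule eq_refl, rule event2_edge)
  have edge: "measure_pmf.prob (mu Dec1) {t. c(e := t) \<in> event3 E U V W}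
      \<le> measure_pmf.prob (mu Dec2) {t. c(e := t) \<in> event3 E U V W}" if "e \<in> E" for e c
    using assms(7-9) that by (rule event3_edge)
  have lower: "measure_pmf.prob (Pi_pmf E undefined (\<lambda>_. mu Dec1)) (event3 E U V W)
      \<le> measure_pmf.prob (config T) (event3 E U V W)"
  proof (rule product_le_tree[OF assms(2)])
    fix d e and c :: "'e \<Rightarrow> triplet" assume "e \<in> E"
    then show "measure_pmf.prob (mu Dec1) {t. c(e := t) \<in> event3 E U V W}
        \<le> measure_pmf.prob (mu d) {t. c(e := t) \<in> event3 E U V W}"
      by (cases d) (simp_all add: edge)
  qed
  have upper: "measure_pmf.prob (config T) (event3 E U V W)
      \<le> measure_pmf.prob (Pi_pmf E undefined (\<lambda>_. mu Dec2)) (event3 E U V W)"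
  proof (rule tree_le_product[OF assms(2)])
    fix d e and c :: "'e \<Rightarrow> triplet" assume "e \<in> E"
    then show "measure_pmf.prob (mu d) {t. c(e := t) \<in> event3 E U V W}
        \<le> measure_pmf.prob (mu Dec2) {t. c(e := t) \<in> event3 E U V W}"
      by (cases d) (simp_all add: edge)
  qed
  show ?thesis
    using lower upper by (simp add: T1 T2 flip: two)
qed

end
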